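(* Let $G$ be a Carnot group of step $s\geq 3$ and topological dimension $n$, identified with $\mathbb{R}^n$ via exponential coordinates of the first kind associated with a basis $(X_1,\dots,X_n)$ of its Lie algebra adapted to the stratification $\mathfrak g=V_1\oplus\cdots\oplus V_s$. Let $K\subset G$ be a set of one of the following two forms: either $$K=\{(x_1,\dots,x_n)\in G:\ c_1|x_1|^{\gamma_1}+\cdots+c_n|x_n|^{\gamma_n}\leq 1\}$$ for some real numbers $\gamma_i>0$, $c_i>0$ ($1\le i\le n$), or $$K=\{x\in G:\ c_1\|\overline{x}_1\|_{d_1}^{\gamma_1}+\cdots+c_s\|\overline{x}_s\|_{d_s}^{\gamma_s}\leq 1\}$$ for some real numbers $\gamma_j>0$, $c_j>0$ ($1\le j\le s$), where $d_j=\dim V_j$, $\overline{x}_j\in\mathbb{R}^{d_j}$ denotes the block of coordinates of $x$ corresponding to the layer $V_j$, and $\|\cdot\|_{d_j}$ is the Euclidean norm on $\mathbb{R}^{d_j}$. Let $d$ be the homogeneous quasi-distance on $G$ induced by $K$, i.e. $$d(p,q)=\inf\{\lambda>0:\ \delta_{1/\lambda}(p^{-1}\cdot q)\in K\}.$$ Then the Besicovitch Covering Property does not hold in $(G,d)$.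
   Context: Quasi-distance: for a nonempty set $X$, a map $d:X\times X\to[0,+\infty)$ is a quasi-distance if it is symmetric, $d(p,q)=0$ if and only if $p=q$, and there is a constant $C\geq1$ with $d(p,q)\leq C(d(p,p')+d(p',q))$ for all $p,p',q\in X$; $(X,d)$ is then called a quasi-metric space. A ball in $(X,d)$ is a set of the form $B_d(p,r):=\{q\in X:\ d(q,p)\leq r\}$ with $p\in X$, $r>0$. Besicovitch Covering Property (BCP): a quasi-metric space $(X,d)$ satisfies BCP if there exists $N\in\mathbb{N}$ such that the following holds: whenever $A$ is a bounded subset of $X$ and $\mathcal{B}$ is a family of balls such that each point of $A$ is the center of some ball of $\mathcal{B}$, there is a finite or countable subfamily $\mathcal{F}\subset\mathcal{B}$ such that the balls in $\mathcal{F}$ cover $A$ and every point of $X$ belongs to at most $N$ balls of $\mathcal{F}$. Carnot groups: a Carnot group $G$ of step $s\geq1$ is a connected and simply connected Lie group whose Lie algebra $\mathfrak g$ is endowed with a stratification $\mathfrak g=V_1\oplus\cdots\oplus V_s$ with $[V_1,V_j]=V_{j+1}$ for $1\leq j\leq s-1$ and $[V_1,V_s]=\{0\}$ (a Carnot group of step $s$ has exactly $s$ nontrivial layers). Let $n=\dim\mathfrak g$. A basis $(X_1,\dots,X_n)$ of $\mathfrak g$ is adapted to the stratification if $(X_{m_{j-1}+1},\dots,X_{m_j})$ is a basis of $V_j$ for $1\leq j\leq s$, where $m_0=0$ and $m_j-m_{j-1}=\dim V_j$. The group $G$ is identified with $\mathbb{R}^n$ by identifying $\exp(x_1X_1+\cdots+x_nX_n)$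 with $(x_1,\dots,x_n)$; the group law $\cdot$ is the corresponding one (given by the Baker-Campbell-Hausdorff formula), with identity $0$. For $x=(x_1,\dots,x_n)$, $\overline{x}_j:=(x_{m_{j-1}+1},\dots,x_{m_j})$. Dilations are $\delta_\lambda(x_1,\dots,x_n)=(\lambda^{\alpha_1}x_1,\dots,\lambda^{\alpha_n}x_n)$, $\lambda>0$, where $\alpha_i=j$ for $m_{j-1}+1\leq i\leq m_j$. Homogeneous quasi-distance: a quasi-distance $d$ on $G$ is homogeneous if it is left-invariant ($d(p\cdot q,p\cdot q')=d(q,q')$ for all $p,q,q'\in G$) and $d(\delta_\lambda(p),\delta_\lambda(q))=\lambda\, d(p,q)$ for all $p,q\in G$, $\lambda>0$. For $K$ as in the claim, the formula for $d$ does define a homogeneous quasi-distance, with $B_d(0,1)=K$. *)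

theory Defs
  imports "HOL-Analysis.Analysis"
begin

subsection \<open>Stratified Lie algebras and adapted bases\<close>

definition lie_bracket :: "('g::real_vector \<Rightarrow> 'g \<Rightarrow> 'g) \<Rightarrow> bool" where
  "lie_bracket br \<longleftrightarrow> bilinear br \<and> (\<forall>x. br x x = 0) \<and>
     (\<forall>x y z. br x (br y z) + br y (br z x) + br z (br x y) = 0)"

definition stratification ::
    "('g::real_vector \<Rightarrow> 'g \<Rightarrow> 'g) \<Rightarrow> nat \<Rightarrow> (nat \<Rightarrow> 'g set) \<Rightarrow> bool" where
  "stratification br s V \<longleftrightarrow> s \<ge> 1 \<and>
     (\<forall>j\<in>{1..s}. subspace (V j) \<and> V j \<noteq> {0}) \<and>
     (\<forall>x. \<exists>!v. v \<in> (\<Pi>\<^sub>E j\<in>{1..s}. V j) \<and> x = (\<Sum>j=1..s. v j)) \<and>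
     (\<forall>j. 1 \<le> j \<and> j < s \<longrightarrow> span {br x y | x y. x \<in> V 1 \<and> y \<in> V j} = V (j + 1)) \<and>
     span {br x y | x y. x \<in> V 1 \<and> y \<in> V s} = {0}"

text \<open>The coordinates of \<open>\<real>\<^sup>n\<close> are indexed by a finite type \<open>'n\<close> with \<open>n\<close> elements, and \<open>deg i\<close>
  is the number of the layer containing \<open>X i\<close>.  The enumeration of the basis layer by layer, through
  \<open>m\<^sub>0 \<le> \<dots> \<le> m\<^sub>s\<close>, is thereby replaced by \<open>deg\<close>; the order of the indices is never used.\<close>

definition adapted_basis ::
    "nat \<Rightarrow> (nat \<Rightarrow> 'g::real_vector set) \<Rightarrow> ('n \<Rightarrow> 'g) \<Rightarrow> ('n \<Rightarrow> nat) \<Rightarrow> bool" where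
  "adapted_basis s V X deg \<longleftrightarrow> inj X \<and> range deg \<subseteq> {1..s} \<and>
     (\<forall>j\<in>{1..s}. independent (X ` {i. deg i = j}) \<and> span (X ` {i. deg i = j}) = V j)"

subsection \<open>The Baker-Campbell-Hausdorff product\<close>

text \<open>Right-nested bracket \<open>[z\<^sub>1, [z\<^sub>2, [\<dots>, z\<^sub>k]]]\<close> of a list.\<close>

fun nested_bracket :: "('g::zero \<Rightarrow> 'g \<Rightarrow> 'g) \<Rightarrow> 'g list \<Rightarrow> 'g" where
  "nested_bracket br [] = 0"
| "nested_bracket br [z] = z"
| "nested_bracket br (z # w # zs) = br z (nested_bracket br (w # zs))"

definition bch_degree :: "(nat \<times> nat) list \<Rightarrow> nat" where
  "bch_degree ps = (\<Sum>(a, b)\<leftarrow>ps. a + b)"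

definition bch_indices :: "nat \<Rightarrow> (nat \<times> nat) list set" where
  "bch_indices s = {ps. ps \<noteq> [] \<and> (\<forall>(a, b)\<in>set ps. a + b > 0) \<and> bch_degree ps \<le> s}"

text \<open>Dynkin's form of the Baker-Campbell-Hausdorff series for \<open>log (exp x exp y)\<close>:
  \<open>\<Sum>\<^sub>k (-1)\<^sup>k\<^sup>-\<^sup>1/k \<Sum> [x\<^sup>a\<^sup>1 y\<^sup>b\<^sup>1 \<dots> x\<^sup>a\<^sup>k y\<^sup>b\<^sup>k] / ((\<Sum>\<^sub>i (a\<^sub>i + b\<^sub>i)) \<Prod>\<^sub>i a\<^sub>i! b\<^sub>i!)\<close>, the inner sum being over
  \<open>(a\<^sub>1, b\<^sub>1), \<dots>, (a\<^sub>k, b\<^sub>k)\<close> with \<open>a\<^sub>i + b\<^sub>i > 0\<close>.  In a Lie algebra that is nilpotent of step \<open>s\<close> the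
  terms of degree greater than \<open>s\<close> vanish, so the truncation at degree \<open>s\<close> is exact.\<close>

definition bch :: "('g::real_vector \<Rightarrow> 'g \<Rightarrow> 'g) \<Rightarrow> nat \<Rightarrow> 'g \<Rightarrow> 'g \<Rightarrow> 'g" where
  "bch br s x y = (\<Sum>ps\<in>bch_indices s.
     ((-1) ^ (length ps - 1) /
       (real (length ps) * real (bch_degree ps) * (\<Prod>(a, b)\<leftarrow>ps. fact a * fact b))) *\<^sub>R
     nested_bracket br (concat (map (\<lambda>(a, b). replicate a x @ replicate b y) ps)))"

text \<open>A sum over an infinite set would be \<open>0\<close>.\<close>

lemma finite_bch_indices: "finite (bch_indices s)"
proof (rule finite_subset)
  show "bch_indices s \<subseteq> {ps. set ps \<subseteq> {..s} \<times> {..s} \<and> length ps \<le> s}"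
  proof
    fix ps assume "ps \<in> bch_indices s"
    then have pos: "\<forall>(a, b)\<in>set ps. a + b > 0" and le: "bch_degree ps \<le> s"
      by (auto simp: bch_indices_def)
    have "length ps \<le> bch_degree ps"
      using pos by (induction ps) (auto simp: bch_degree_def)
    moreover have "a + b \<le> bch_degree ps" if "(a, b) \<in> set ps" for a b
      using that by (induction ps) (auto simp: bch_degree_def)
    ultimately show "ps \<in> {ps. set ps \<subseteq> {..s} \<times> {..s} \<and> length ps \<le> s}"
      using le by fastforce
  qed
  show "finite {ps. set ps \<subseteq> {..s} \<times> {..s} \<and> length ps \<le> s}"
    by (rule finite_lists_length_le) simp
qed

subsection \<open>Exponential coordinates of the first kind\<close>

definition lie_of_coords :: "('n::finite \<Rightarrow> 'g::real_vector) \<Rightarrow> real ^ 'n \<Rightarrow> 'g" where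
  "lie_of_coords X x = (\<Sum>i\<in>UNIV. (x $ i) *\<^sub>R X i)"

definition carnot_mult ::
    "('g::real_vector \<Rightarrow> 'g \<Rightarrow> 'g) \<Rightarrow> nat \<Rightarrow> ('n::finite \<Rightarrow> 'g) \<Rightarrow> real ^ 'n \<Rightarrow> real ^ 'n \<Rightarrow> real ^ 'n" where
  "carnot_mult br s X p q =
     inv (lie_of_coords X) (bch br s (lie_of_coords X p) (lie_of_coords X q))"

text \<open>As \<open>exp(x)\<^sup>-\<^sup>1 = exp(-x)\<close>, the group inverse is the negative in these coordinates.\<close>

definition carnot_inverse :: "real ^ 'n \<Rightarrow> real ^ 'n" where
  "carnot_inverse p = - p"

definition dilation :: "('n::finite \<Rightarrow> nat) \<Rightarrow> real \<Rightarrow> real ^ 'n \<Rightarrow> real ^ 'n" where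
  "dilation deg t x = (\<chi> i. t ^ deg i * x $ i)"

definition induced_dist ::
    "('g::real_vector \<Rightarrow> 'g \<Rightarrow> 'g) \<Rightarrow> nat \<Rightarrow> ('n::finite \<Rightarrow> 'g) \<Rightarrow> ('n \<Rightarrow> nat) \<Rightarrow> (real ^ 'n) set
      \<Rightarrow> real ^ 'n \<Rightarrow> real ^ 'n \<Rightarrow> real" where
  "induced_dist br s X deg K p q =
     Inf {t. t > 0 \<and> dilation deg (1 / t) (carnot_mult br s X (carnot_inverse p) q) \<in> K}"

subsection \<open>The Besicovitch Covering Property\<close>

text \<open>These notions are meant for a quasi-distance \<open>d\<close> on the whole type \<open>'a\<close>.
  Balls are sets, without a distinguished center or radius.\<close>

definition qball :: "('a \<Rightarrow> 'a \<Rightarrow> real) \<Rightarrow> 'a \<Rightarrow> real \<Rightarrow> 'a set" where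
  "qball d p r = {q. d q p \<le> r}"

definition qbounded :: "('a \<Rightarrow> 'a \<Rightarrow> real) \<Rightarrow> 'a set \<Rightarrow> bool" where
  "qbounded d A \<longleftrightarrow> (\<exists>R. \<forall>p\<in>A. \<forall>q\<in>A. d p q \<le> R)"

definition BCP :: "('a \<Rightarrow> 'a \<Rightarrow> real) \<Rightarrow> bool" where
  "BCP d \<longleftrightarrow> (\<exists>N::nat. \<forall>A \<B>.
     qbounded d A \<and> (\<forall>B\<in>\<B>. \<exists>p r. r > 0 \<and> B = qball d p r) \<and>
     (\<forall>p\<in>A. \<exists>r>0. qball d p r \<in> \<B>) \<longrightarrow>
     (\<exists>\<F>. \<F> \<subseteq> \<B> \<and> countable \<F> \<and> A \<subseteq> \<Union>\<F> \<and>
        (\<forall>x. finite {B \<in> \<F>. x \<in> B} \<and> card {B \<in> \<F>. x \<in> B} \<le> N)))"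

end

theory Submission
  imports Defs "HOL-Real_Asymp.Real_Asymp"
begin

text \<open>
  BCP fails as soon as, for every \<open>n\<close>, there are \<open>n\<close> balls with a common point none of which contains
  the center of another one.  Such balls are found in a Heisenberg subgroup.  Choose basis vectors
  \<open>u \<in> V\<^sub>1\<close> and \<open>v \<in> V\<^sub>s\<^sub>-\<^sub>1\<close> with \<open>w = [u, v] \<noteq> 0\<close>.  Since \<open>s \<ge> 3\<close>, all other brackets of \<open>u, v, w\<close>
  vanish, so that the product of \<open>x u + y v + z w\<close> with \<open>x' u + y' v + z' w\<close> involves only the first
  bracket, and \<open>K\<close> becomes \<open>A |x|\<^sup>\<alpha> + B |y|\<^sup>\<beta> + h(|z|) \<le> 1\<close> with dilation weights \<open>1, s - 1, s\<close>.
  As \<open>s - 1 \<ge> 2\<close>, only the \<open>x\<close>-coordinate of a small dilate matters to first order.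

  If \<open>\<alpha> > 1\<close>, take \<open>p = (a, -b, z)\<close> on the boundary of \<open>K\<close> and very sparse dilates of \<open>p\<close>.  To first order
  in \<open>\<epsilon>\<close>, the passage from \<open>p\<close> to \<open>(\<delta>\<^sub>\<epsilon> p)\<^sup>-\<^sup>1 p\<close> changes \<open>x\<close> by \<open>-\<epsilon> a\<close> and \<open>z\<close> by \<open>\<epsilon> a b / 2\<close>; the
  resulting loss of order \<open>a\<^sup>\<alpha>\<close> is beaten by the gain of order \<open>a\<close> when \<open>a\<close> is small.

  If \<open>\<alpha> \<le> 1\<close>, take points \<open>(x\<^sub>i, 0, z\<^sub>i)\<close> with \<open>x\<^sub>i\<close> decreasing geometrically and \<open>z\<^sub>i\<close> increasing very
  fast.  At scale \<open>\<rho>\<close> the differences of the \<open>x\<^sub>i\<close> contribute a gain of order \<open>\<rho>\<^sup>-\<^sup>\<alpha>\<close>, whereas the \<open>z\<^sub>i\<close>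
  cost only \<open>O(\<rho>\<^sup>-\<^sup>s)\<close>.
\<close>

subsection \<open>Separated families of balls\<close>

text \<open>Take \<open>N + 1\<close> centers as the set to be covered. No ball contains the center
  of another one, so a covering subfamily must keep all of them, and all contain \<open>e\<close>.
  The hypothesis \<open>d (P i) (P i) \<le> r i\<close> stands in for \<open>d p p = 0\<close>, as
  no axioms are imposed on \<open>d\<close>.\<close>

lemma not_BCP_if_separated:
  fixes d :: "'a \<Rightarrow> 'a \<Rightarrow> real"
  assumes "\<And>n::nat. \<exists>P r. \<forall>i<n. r i > 0 \<and> d e (P i) \<le> r i \<and> d (P i) (P i) \<le> r i \<and>
             (\<forall>j<n. j \<noteq> i \<longrightarrow> r j < d (P i) (P j))"
  shows "\<not> BCP d"
proof
  assume "BCP d"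
  then obtain N where N: "\<forall>A \<B>.
     qbounded d A \<and> (\<forall>B\<in>\<B>. \<exists>p r. r > 0 \<and> B = qball d p r) \<and>
     (\<forall>p\<in>A. \<exists>r>0. qball d p r \<in> \<B>) \<longrightarrow>
     (\<exists>\<F>. \<F> \<subseteq> \<B> \<and> countable \<F> \<and> A \<subseteq> \<Union>\<F> \<and>
        (\<forall>x. finite {B \<in> \<F>. x \<in> B} \<and> card {B \<in> \<F>. x \<in> B} \<le> N))"
    unfolding BCP_def by (elim exE)
  from assms[of "Suc N"]
  obtain P r where P: "\<And>i. i < Suc N \<Longrightarrow> r i > 0 \<and> d e (P i) \<le> r i \<and> d (P i) (P i) \<le> r i \<and>
             (\<forall>j<Suc N. j \<noteq> i \<longrightarrow> r j < d (P i) (P j))"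
    by blast
  define B where "B i = qball d (P i) (r i)" for i
  have mem: "P i \<in> B j \<longleftrightarrow> i = j" if "i < Suc N" "j < Suc N" for i j
    using P[OF that(1)] that by (cases "i = j") (auto simp: B_def qball_def not_le)
  have bdd: "qbounded d (P ` {..<Suc N})"
    unfolding qbounded_def
  proof (intro exI ballI)
    let ?D = "(\<lambda>(p, q). d p q) ` (P ` {..<Suc N} \<times> P ` {..<Suc N})"
    fix p q assume "p \<in> P ` {..<Suc N}" "q \<in> P ` {..<Suc N}"
    then have "d p q \<in> ?D" by (intro image_eqI[where x = "(p, q)"]) simp_all
    then show "d p q \<le> Max ?D" by (intro Max_ge) simp_all
  qed
  have B1: "\<forall>C\<in>B ` {..<Suc N}. \<exists>p r. r > 0 \<and> C = qball d p r"
    using P by (auto simp: B_def)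
  have B2: "\<forall>p\<in>P ` {..<Suc N}. \<exists>\<rho>>0. qball d p \<rho> \<in> B ` {..<Suc N}"
    using P by (force simp: B_def)
  obtain \<F> where F: "\<F> \<subseteq> B ` {..<Suc N}" "P ` {..<Suc N} \<subseteq> \<Union>\<F>"
      and card: "\<And>x. card {C \<in> \<F>. x \<in> C} \<le> N"
    using N[THEN spec, THEN spec, THEN mp, OF conjI[OF bdd conjI[OF B1 B2]]] by (elim exE conjE) blast
  have "B i \<in> {C \<in> \<F>. e \<in> C}" if "i < Suc N" for i
  proof -
    from F(2) that obtain C where C: "C \<in> \<F>" "P i \<in> C" by blast
    with F(1) obtain j where "j < Suc N" "C = B j" by blast
    with C that mem have "B i \<in> \<F>" by metis
    moreover have "e \<in> B i" using P[OF that] by (simp add: B_def qball_def)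
    ultimately show ?thesis by simp
  qed
  then have "B ` {..<Suc N} \<subseteq> {C \<in> \<F>. e \<in> C}" by auto
  moreover have "finite {C \<in> \<F>. e \<in> C}"
    using finite_subset[OF F(1)] by simp
  ultimately have "card (B ` {..<Suc N}) \<le> N"
    using card[of e] card_mono le_trans by metis
  \<comment> \<open>BCP counts balls as sets, so different indices must give different sets; the
    centers tell them apart.\<close>
  moreover have "inj_on B {..<Suc N}"
    by (rule inj_onI) (metis lessThan_iff mem)
  ultimately show False by (simp add: card_image)
qed

text \<open>Induction on the size of the family. The extension step knows only \<open>Q\<close>
  about the old pairs, so \<open>Q\<close> has to carry whatever the choice of the next point relies
  on.\<close>

lemma separated_sequence:
  fixes d :: "'a \<Rightarrow> 'a \<Rightarrow> real" and n :: nat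
  assumes step: "\<And>n P r. (\<forall>i<n::nat. Q (P i) (r i)) \<Longrightarrow>
      \<exists>p \<rho>. Q p \<rho> \<and> (\<forall>i<n. r i < d p (P i) \<and> \<rho> < d (P i) p)"
  shows "\<exists>P r. \<forall>i<n. Q (P i) (r i) \<and> (\<forall>j<n. j \<noteq> i \<longrightarrow> r j < d (P i) (P j))"
proof (induction n)
  case (Suc n)
  then obtain P r where IH: "\<And>i. i < n \<Longrightarrow> Q (P i) (r i) \<and> (\<forall>j<n. j \<noteq> i \<longrightarrow> r j < d (P i) (P j))"
    by blast
  with step[of n P r] obtain p \<rho> where
    "Q p \<rho>" "\<And>i. i < n \<Longrightarrow> r i < d p (P i) \<and> \<rho> < d (P i) p"
    by blast
  with IH show ?case
    by (intro exI[of _ "P(n := p)"] exI[of _ "r(n := \<rho>)"]) (simp add: less_Suc_eq all_conj_distrib imp_conjL)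
qed simp

subsection \<open>Gauges on the Heisenberg group\<close>

text \<open>\<open>h\<close> stays abstract because the bracket w may have several nonzero
  coordinates with different exponents. A sum of such powers can fail to be differentiable at 0,
  hence derivatives only at \<open>z > 0\<close>.\<close>

locale heisenberg_gauge =
  fixes A \<alpha> B \<beta> :: real and h :: "real \<Rightarrow> real" and s :: nat
  assumes pos: "A > 0" "\<alpha> > 0" "B > 0" "\<beta> > 0"
    and s3: "s \<ge> 3"
    and h_zero: "h 0 = 0"
    and h_minus: "h (- z) = h z"
    and h_mono: "0 \<le> z \<Longrightarrow> z \<le> z' \<Longrightarrow> h z \<le> h z'"
    and h_cont: "continuous_on UNIV h"
    and h_ge_one: "\<exists>z>0. h z \<ge> 1"
    and h_deriv: "z > 0 \<Longrightarrow> \<exists>D>0. (h has_real_derivative D) (at z)"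
begin

definition N :: "real \<Rightarrow> real \<Rightarrow> real \<Rightarrow> real" where
  "N x y z = A * \<bar>x\<bar> powr \<alpha> + B * \<bar>y\<bar> powr \<beta> + h z"

definition gauge_set :: "real \<Rightarrow> real \<Rightarrow> real \<Rightarrow> real set" where
  "gauge_set x y z = {t. t > 0 \<and> N (x / t) (y / t ^ (s - 1)) (z / t ^ s) \<le> 1}"

text \<open>The arguments of \<open>gauge_set\<close> are the exponential coordinates of the inverse
  of the first point times the second.\<close>

definition hdist :: "real \<times> real \<times> real \<Rightarrow> real \<times> real \<times> real \<Rightarrow> real" where
  "hdist = (\<lambda>(x, y, z) (x', y', z').
     Inf (gauge_set (x' - x) (y' - y) (z' - z - (x * y' - y * x') / 2)))"

lemma h_abs: "h \<bar>z\<bar> = h z"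
  by (simp add: abs_if h_minus)

lemma h_mono_abs: "\<bar>z\<bar> \<le> \<bar>z'\<bar> \<Longrightarrow> h z \<le> h z'"
  using h_mono[of "\<bar>z\<bar>" "\<bar>z'\<bar>"] by (simp add: h_abs)

lemma N_mono:
  assumes "\<bar>x\<bar> \<le> \<bar>x'\<bar>" "\<bar>y\<bar> \<le> \<bar>y'\<bar>" "\<bar>z\<bar> \<le> \<bar>z'\<bar>"
  shows "N x y z \<le> N x' y' z'"
  unfolding N_def using assms pos
  by (intro add_mono mult_left_mono powr_mono2 h_mono_abs) auto

lemma N_minus: "N (- x) (- y) (- z) = N x y z"
  by (simp add: N_def h_minus)

text \<open>Swapping the points inverts this group element, which negates its coordinates, and
  \<open>N\<close> is even.\<close>

lemma hdist_commute: "hdist p q = hdist q p"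
proof -
  have *: "gauge_set (- x) (- y) (- z) = gauge_set x y z" for x y z
    by (simp add: gauge_set_def N_minus)
  obtain x y z x' y' z' where pq: "p = (x, y, z)" "q = (x', y', z')"
    by (metis prod_cases3)
  have "z' - z - (x * y' - y * x') / 2 = - (z - z' - (x' * y - y' * x) / 2)"
    by (simp add: field_simps)
  moreover have "x' - x = - (x - x')" "y' - y = - (y - y')" by simp_all
  ultimately show ?thesis
    unfolding pq hdist_def prod.case by (simp only: *)
qed

lemma Inf_gauge_le:
  assumes "N (x / r) (y / r ^ (s - 1)) (z / r ^ s) \<le> 1" "r > 0"
  shows "Inf (gauge_set x y z) \<le> r"
  using assms by (intro cInf_lower bdd_belowI[of _ 0]) (auto simp: gauge_set_def)

lemma continuous_N_scaled:
  "continuous_on {0<..} (\<lambda>t. N (x / t) (y / t ^ (s - 1)) (z / t ^ s))"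
proof -
  have "continuous_on {0<..} (\<lambda>t. h (z / t ^ s))"
    by (rule continuous_on_compose2[OF h_cont]) (auto intro!: continuous_intros)
  then show ?thesis
    unfolding N_def using pos by (intro continuous_intros continuous_on_powr') auto
qed

text \<open>Division by large \<open>t\<close> moves every point towards the origin, where
  \<open>N\<close> vanishes. This keeps \<open>Inf\<close> from being applied to the empty
  set.\<close>

lemma gauge_set_nonempty: "gauge_set x y z \<noteq> {}"
proof -
  have powr0: "((\<lambda>t. C * \<bar>f t\<bar> powr \<kappa>) \<longlongrightarrow> 0) at_top"
    if "(f \<longlongrightarrow> 0) at_top" "\<kappa> > 0" for C \<kappa> :: real and f :: "real \<Rightarrow> real"
    using tendsto_mult[OF tendsto_const tendsto_powr2[OF tendsto_rabs[OF that(1)] tendsto_const]] that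
    by simp
  have pow0: "((\<lambda>t. c / t ^ k) \<longlongrightarrow> 0) at_top" if "k > 0" for c :: real and k
    using that by real_asymp
  have "isCont h 0"
    using h_cont by (simp add: continuous_on_eq_continuous_at)
  then have "((\<lambda>t. h (z / t ^ s)) \<longlongrightarrow> h 0) at_top"
    using s3 by (intro isCont_tendsto_compose[of _ h] pow0) auto
  moreover have "((\<lambda>t. A * \<bar>x / t\<bar> powr \<alpha>) \<longlongrightarrow> 0) at_top"
    using pos pow0[of 1] by (intro powr0) auto
  moreover have "((\<lambda>t. B * \<bar>y / t ^ (s - 1)\<bar> powr \<beta>) \<longlongrightarrow> 0) at_top"
    using pos s3 by (intro powr0 pow0) auto
  ultimately have "((\<lambda>t. N (x / t) (y / t ^ (s - 1)) (z / t ^ s)) \<longlongrightarrow> 0 + 0 + h 0) at_top"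
    unfolding N_def by (intro tendsto_add)
  then have "eventually (\<lambda>t. N (x / t) (y / t ^ (s - 1)) (z / t ^ s) < 1) at_top"
    by (rule order_tendstoD) (simp add: h_zero)
  from eventually_conj[OF this eventually_gt_at_top[of 0]]
  obtain t where "N (x / t) (y / t ^ (s - 1)) (z / t ^ s) < 1" "t > 0"
    using eventually_happens by fastforce
  then show ?thesis by (force simp: gauge_set_def)
qed

text \<open>By continuity \<open>N\<close> still exceeds 1 at a scale slightly above
  \<open>r\<close>, and monotonicity then excludes all smaller scales. This slack makes the
  inequality strict.\<close>

lemma Inf_gauge_gt:
  assumes N: "N (x / r) (y / r ^ (s - 1)) (z / r ^ s) > 1" and "r > 0"
  shows "Inf (gauge_set x y z) > r"
proof -
  let ?\<phi> = "\<lambda>t. N (x / t) (y / t ^ (s - 1)) (z / t ^ s)"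
  have "isCont ?\<phi> r"
    using continuous_N_scaled \<open>r > 0\<close> by (simp add: continuous_on_eq_continuous_at)
  then have "(?\<phi> \<longlongrightarrow> ?\<phi> r) (at r)" by (simp add: isCont_def)
  then have "eventually (\<lambda>t. ?\<phi> t > 1) (at r)"
    using N by (rule order_tendstoD)
  then obtain \<epsilon> where \<epsilon>: "\<epsilon> > 0" "\<And>t. t \<noteq> r \<Longrightarrow> dist t r < \<epsilon> \<Longrightarrow> ?\<phi> t > 1"
    by (auto simp: eventually_at)
  have gt: "?\<phi> (r + \<epsilon> / 2) > 1"
    using \<epsilon> by (auto simp: dist_real_def)
  have "r + \<epsilon> / 2 \<le> t" if "t \<in> gauge_set x y z" for t
  proof (rule ccontr)
    assume "\<not> r + \<epsilon> / 2 \<le> t"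
    with that have "?\<phi> (r + \<epsilon> / 2) \<le> ?\<phi> t"
      by (intro N_mono) (auto simp: gauge_set_def abs_divide intro!: divide_left_mono power_mono
          mult_pos_pos)
    with that gt show False by (simp add: gauge_set_def)
  qed
  then have "r + \<epsilon> / 2 \<le> Inf (gauge_set x y z)"
    by (intro cInf_greatest gauge_set_nonempty)
  with \<epsilon> show ?thesis by simp
qed

lemma hdist_self_le: "r > 0 \<Longrightarrow> hdist p p \<le> r"
  by (cases p) (auto simp: hdist_def N_def h_zero intro!: Inf_gauge_le)

section \<open>Separated families of balls in the Heisenberg group\<close>

lemma h_attains:
  assumes "0 < v" "v \<le> 1"
  obtains z where "z > 0" "h z = v"
proof -
  obtain z1 where "z1 > 0" "h z1 \<ge> 1" using h_ge_one by blast
  with assms obtain z where "0 \<le> z" "h z = v"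
    using IVT'[of h 0 v z1] h_zero h_cont continuous_on_subset by (metis less_eq_real_def order_trans top_greatest)
  moreover from this assms have "z \<noteq> 0" by (auto simp: h_zero)
  ultimately show thesis using that[of z] by simp
qed

text \<open>The last gauge is that of the inverse of the \<epsilon>-dilate of p =
  \<open>(a, - b, z)\<close> times p. Its derivative at \<epsilon> = 0 is
  \<open>a * (D * b / 2 - \<alpha> * A * a powr (\<alpha> - 1))\<close>, positive for small
  \<open>a\<close> because \<alpha> > 1 and \<open>b\<close> stays bounded below.\<close>

lemma self_similar_point:
  assumes "\<alpha> > 1"
  obtains a b z \<delta> where "a > 0" "\<delta> > 0" "N a (- b) z = 1"
    "\<And>\<epsilon>. 0 < \<epsilon> \<Longrightarrow> \<epsilon> < \<delta> \<Longrightarrow>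
      N (a - \<epsilon> * a) (- b + \<epsilon> ^ (s - 1) * b) (z - \<epsilon> ^ s * z + a * b / 2 * (\<epsilon> - \<epsilon> ^ (s - 1))) > 1"
proof -
  obtain z where z: "z > 0" "h z = 1 / 2" using h_attains[of "1/2"] by auto
  obtain D where D: "D > 0" "(h has_real_derivative D) (at z)" using h_deriv z by blast
  \<comment> \<open>A lower bound for \<open>b\<close> independent of \<open>a\<close>: the terms
    \<open>h z = 1 / 2\<close> and \<open>A * a powr \<alpha> < 1 / 4\<close> leave more than 1/4
    for the second coordinate.\<close>
  define b0 where "b0 = (1 / (4 * B)) powr (1 / \<beta>)"
  have b0: "b0 > 0" using pos by (simp add: b0_def)
  have "((\<lambda>a. A * a powr \<alpha>) \<longlongrightarrow> A * 0 powr \<alpha>) (at_right 0)"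
    using pos by (intro tendsto_intros tendsto_powr2) (auto simp: eventually_at_filter)
  then have ev1: "eventually (\<lambda>a. A * a powr \<alpha> < 1 / 4) (at_right 0)"
    by (rule order_tendstoD) simp
  have "((\<lambda>a. \<alpha> * A * a powr (\<alpha> - 1)) \<longlongrightarrow> \<alpha> * A * 0 powr (\<alpha> - 1)) (at_right 0)"
    using assms by (intro tendsto_intros tendsto_powr2) (auto simp: eventually_at_filter)
  then have ev2: "eventually (\<lambda>a. \<alpha> * A * a powr (\<alpha> - 1) < D * b0 / 2) (at_right 0)"
    using D b0 by (intro order_tendstoD) auto
  obtain a where a: "a > 0" "A * a powr \<alpha> < 1 / 4" "\<alpha> * A * a powr (\<alpha> - 1) < D * b0 / 2"
    using eventually_happens[OF eventually_conj[OF eventually_at_right_less eventually_conj[OF ev1 ev2]]]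
    by auto
  define b where "b = ((1 / 2 - A * a powr \<alpha>) / B) powr (1 / \<beta>)"
  have "b0 \<le> b"
    unfolding b_def b0_def using a pos by (intro powr_mono2) (auto simp: field_simps)
  with b0 have b: "b > 0" by simp
  have "B * b powr \<beta> = 1 / 2 - A * a powr \<alpha>"
    using a pos by (simp add: b_def powr_powr)
  then have N1: "N a (- b) z = 1"
    using a b z by (simp add: N_def)
  \<comment> \<open>The gauge without absolute values around the first two coordinates; the two
    agree for 0 < \<epsilon> < 1, whence \<open>min \<delta> 1\<close> below. The powers of
    \<epsilon> with exponents \<open>s\<close> and \<open>s - 1\<close> have derivative 0 at
    0.\<close>
  define F where "F \<epsilon> = A * (a - \<epsilon> * a) powr \<alpha> + B * (b - \<epsilon> ^ (s - 1) * b) powr \<beta> +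
      h (z - \<epsilon> ^ s * z + a * b / 2 * (\<epsilon> - \<epsilon> ^ (s - 1)))" for \<epsilon>
  have "((\<lambda>\<epsilon>. h (z - \<epsilon> ^ s * z + a * b / 2 * (\<epsilon> - \<epsilon> ^ (s - 1)))) has_real_derivative
      D * (a * b / 2)) (at 0)"
    by (rule DERIV_chain2[where f = h])
      (use D s3 in \<open>auto simp: power_0_left intro!: derivative_eq_intros\<close>)
  then have "(F has_real_derivative - (\<alpha> * A * a powr (\<alpha> - 1) * a) + D * (a * b / 2)) (at 0)"
    unfolding F_def using a b s3
    by (auto simp: power_0_left intro!: derivative_eq_intros)
  moreover have "- (\<alpha> * A * a powr (\<alpha> - 1) * a) + D * (a * b / 2) > 0"
  proof -
    have "\<alpha> * A * a powr (\<alpha> - 1) < D * b / 2"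
      using a(3) mult_left_mono[OF \<open>b0 \<le> b\<close>, of D] D by linarith
    from mult_strict_right_mono[OF this a(1)] show ?thesis by (simp add: algebra_simps)
  qed
  ultimately obtain \<delta> where \<delta>: "\<delta> > 0" "\<And>\<epsilon>. 0 < \<epsilon> \<Longrightarrow> \<epsilon> < \<delta> \<Longrightarrow> F 0 < F \<epsilon>"
    using DERIV_pos_inc_right by (metis add_0)
  have F0: "F 0 = 1"
    using N1 a b s3 by (simp add: F_def N_def power_0_left)
  show thesis
  proof (rule that[of a "min \<delta> 1" b z])
    fix \<epsilon> :: real assume \<epsilon>: "0 < \<epsilon>" "\<epsilon> < min \<delta> 1"
    have "\<epsilon> * a \<le> a" using \<epsilon> a by simp
    moreover have "\<epsilon> ^ (s - 1) * b \<le> b" using \<epsilon> b by (simp add: power_le_one)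
    ultimately show "N (a - \<epsilon> * a) (- b + \<epsilon> ^ (s - 1) * b) (z - \<epsilon> ^ s * z + a * b / 2 * (\<epsilon> - \<epsilon> ^ (s - 1))) > 1"
      using \<delta>(2)[of \<epsilon>] \<epsilon> F0 by (simp add: N_def F_def)
  qed (use a \<delta> N1 in auto)
qed

text \<open>The identity serves as the common point of the balls.\<close>

definition admissible :: "real \<times> real \<times> real \<Rightarrow> real \<Rightarrow> bool" where
  "admissible p r \<longleftrightarrow> r > 0 \<and> hdist (0, 0, 0) p \<le> r"

lemma admissibleI:
  "r > 0 \<Longrightarrow> N (x / r) (y / r ^ (s - 1)) (z / r ^ s) \<le> 1 \<Longrightarrow> admissible (x, y, z) r"
  by (auto simp: admissible_def hdist_def intro!: Inf_gauge_le)

text \<open>All centers are dilates \<open>pt \<rho>\<close> of one point, with radius \<rho>.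
  Rescaled by \<rho>, a pair of them is the situation of \<open>self_similar_point\<close> with
  \<epsilon> = r / \<rho>, so sufficiently fast growing radii suffice.\<close>

lemma separated_large_exponent:
  assumes "\<alpha> > 1"
  shows "\<exists>P r. \<forall>i<n::nat. admissible (P i) (r i) \<and> (\<forall>j<n. j \<noteq> i \<longrightarrow> r j < hdist (P i) (P j))"
proof -
  obtain a b z \<delta> where \<delta>: "\<delta> > 0" and N1: "N a (- b) z = 1" and
    N_gt: "\<And>\<epsilon>. 0 < \<epsilon> \<Longrightarrow> \<epsilon> < \<delta> \<Longrightarrow>
      N (a - \<epsilon> * a) (- b + \<epsilon> ^ (s - 1) * b) (z - \<epsilon> ^ s * z + a * b / 2 * (\<epsilon> - \<epsilon> ^ (s - 1))) > 1"
    using self_similar_point[OF assms] by metis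
  define pt where "pt \<rho> = (\<rho> * a, - (\<rho> ^ (s - 1) * b), \<rho> ^ s * z)" for \<rho>
  have far: "hdist (pt r) (pt \<rho>) > \<rho>" if r: "0 < r" "r < \<delta> * \<rho>" "\<rho> > 0" for r \<rho>
  proof -
    have s: "\<rho> ^ s = \<rho> * \<rho> ^ (s - 1)" "r ^ s = r * r ^ (s - 1)"
      using s3 by (metis Suc_diff_1 gr0I not_numeral_le_zero power_Suc)+
    define \<epsilon> where "\<epsilon> = r / \<rho>"
    have eqs: "(\<rho> * a - r * a) / \<rho> = a - \<epsilon> * a"
      "(- (\<rho> ^ (s - 1) * b) - - (r ^ (s - 1) * b)) / \<rho> ^ (s - 1) = - b + \<epsilon> ^ (s - 1) * b"
      "(\<rho> ^ s * z - r ^ s * z - (r * a * - (\<rho> ^ (s - 1) * b) - - (r ^ (s - 1) * b) * (\<rho> * a)) / 2) / \<rho> ^ s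
        = z - \<epsilon> ^ s * z + a * b / 2 * (\<epsilon> - \<epsilon> ^ (s - 1))"
      using r by (simp_all add: \<epsilon>_def power_divide s field_simps)
    have "0 < \<epsilon>" "\<epsilon> < \<delta>" using r by (simp_all add: \<epsilon>_def field_simps)
    from N_gt[OF this] show ?thesis
      unfolding pt_def hdist_def prod.case using r by (intro Inf_gauge_gt) (simp_all only: eqs)
  qed
  have adm: "admissible (pt \<rho>) \<rho>" if "\<rho> > 0" for \<rho>
    using that N1 unfolding pt_def by (intro admissibleI) simp_all
  have "\<exists>P r. \<forall>i<n. (r i > 0 \<and> P i = pt (r i)) \<and> (\<forall>j<n. j \<noteq> i \<longrightarrow> r j < hdist (P i) (P j))"
  proof (rule separated_sequence[where d = hdist and Q = "\<lambda>p r. r > 0 \<and> p = pt r"])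
    fix n :: nat and P r
    assume P: "\<forall>i<n. 0 < r i \<and> P i = pt (r i)"
    \<comment> \<open>Exceeds both \<open>r i\<close> and \<open>r i / \<delta>\<close> for every
      old index; the summand 1 keeps it positive when \<open>n = 0\<close>.\<close>
    define \<rho> where "\<rho> = 1 + (\<Sum>i<n. r i * (1 + 1 / \<delta>))"
    have r: "r i * (1 + 1 / \<delta>) < \<rho>" if "i < n" for i
    proof -
      have "r i * (1 + 1 / \<delta>) \<le> (\<Sum>i<n. r i * (1 + 1 / \<delta>))"
        using P \<delta> that by (intro member_le_sum) (auto intro!: mult_nonneg_nonneg simp: less_imp_le)
      then show ?thesis by (simp add: \<rho>_def)
    qed
    have "\<rho> > 0" unfolding \<rho>_def using P \<delta>
      by (intro add_pos_nonneg sum_nonneg mult_nonneg_nonneg) (auto simp: less_imp_le)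
    moreover have "r i < hdist (pt \<rho>) (P i) \<and> \<rho> < hdist (P i) (pt \<rho>)" if "i < n" for i
    proof -
      have ri: "r i > 0" "P i = pt (r i)" using P that by auto
      then have "r i / \<delta> > 0" using \<delta> by simp
      then have "r i < \<rho>" "r i / \<delta> < \<rho>" using r[OF that] ri by (auto simp: algebra_simps)
      then have "r i < \<delta> * \<rho>" using \<delta> by (simp add: field_simps)
      with far[of "r i" \<rho>] ri \<open>\<rho> > 0\<close> \<open>r i < \<rho>\<close> show ?thesis
        by (auto simp: hdist_commute[of "pt \<rho>"])
    qed
    ultimately show "\<exists>p \<rho>. (0 < \<rho> \<and> p = pt \<rho>) \<and> (\<forall>i<n. r i < hdist p (P i) \<and> \<rho> < hdist (P i) p)"
      by blast
  qed
  with adm show ?thesis by metis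
qed

text \<open>With second coordinates 0 the bracket term vanishes and differences are coordinatewise.
  Each new center has a smaller first coordinate and a larger radius than the old ones.\<close>

lemma separated_small_exponent:
  assumes "\<alpha> \<le> 1"
  shows "\<exists>P r. \<forall>i<n::nat. admissible (P i) (r i) \<and> (\<forall>j<n. j \<noteq> i \<longrightarrow> r j < hdist (P i) (P j))"
proof -
  obtain T where T: "T > 0" "h T = 1" using h_attains[of 1] by auto
  obtain H where H: "H > 0" "(h has_real_derivative H) (at T)" using h_deriv T by blast
  have "\<exists>P r. \<forall>i<n. (admissible (P i) (r i) \<and> fst (P i) > 0 \<and> fst (snd (P i)) = 0) \<and>
      (\<forall>j<n. j \<noteq> i \<longrightarrow> r j < hdist (P i) (P j))"
  proof (rule separated_sequence[where d = hdist and
        Q = "\<lambda>p r. admissible p r \<and> fst p > 0 \<and> fst (snd p) = 0"])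
    fix n :: nat and P r
    assume P: "\<forall>i<n. admissible (P i) (r i) \<and> fst (P i) > 0 \<and> fst (snd (P i)) = 0"
    define x where "x i = fst (P i)" for i
    define z where "z i = snd (snd (P i))" for i
    have P_eq: "P i = (x i, 0, z i)" and x_pos: "x i > 0" if "i < n" for i
      using P that by (auto simp: x_def z_def prod_eq_iff)
    have r_pos: "r i > 0" if "i < n" for i using P that by (auto simp: admissible_def)
    \<comment> \<open>The factor 3 yields \<open>x i - w \<ge> 2 * w\<close>, the source of
      \<open>2 powr \<alpha>\<close> below; inserting 1 covers \<open>n = 0\<close>.\<close>
    define w where "w = Min (insert 1 (x ` {..<n})) / 3"
    have w: "w > 0" using x_pos by (auto simp: w_def)
    have w_le: "3 * w \<le> x i" if "i < n" for i
      using that by (auto simp: w_def)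
    \<comment> \<open>With \<open>\<tau> = \<rho>\<^sup>-\<^sup>\<alpha>\<close> and third coordinate \<open>T - D \<tau>\<close> at scale \<open>\<rho>\<close>: the new point has gauge at most \<open>\<rho>\<close>
      if \<open>h' T * D > a\<close>, and it is far from the old ones if \<open>h' T * D < a * 2\<^sup>\<alpha>\<close>, to first order in \<open>\<tau>\<close>.
      This \<open>D\<close> is halfway.\<close>
    define a where "a = A * w powr \<alpha>"
    define D where "D = a * (1 + 2 powr \<alpha>) / 2 / H"
    have a: "a > 0" using pos w by (simp add: a_def)
    have two: "2 powr \<alpha> > 1" using pos by simp
    have a2: "a < a * 2 powr \<alpha>" using mult_strict_left_mono[OF two a] by simp
    have HD: "H * D = a * (1 + 2 powr \<alpha>) / 2" using H by (simp add: D_def)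
    have D: "D > 0" using a H two by (simp add: D_def)
    have "((\<lambda>\<tau>. - (h (T - D * \<tau>) + a * \<tau>)) has_real_derivative - (H * - D + a)) (at 0)"
      by (rule DERIV_minus, rule DERIV_add, rule DERIV_chain2[where f = h])
        (use H in \<open>auto intro!: derivative_eq_intros\<close>)
    moreover have "- (H * - D + a) > 0" using HD a2 by (simp add: algebra_simps)
    ultimately obtain \<delta> where "\<delta> > 0" "\<And>\<tau>. 0 < \<tau> \<Longrightarrow> \<tau> < \<delta> \<Longrightarrow> h (T - D * \<tau>) + a * \<tau> < 1"
      using DERIV_pos_inc_right T by force
    then have ev1: "eventually (\<lambda>\<tau>. h (T - D * \<tau>) + a * \<tau> < 1) (at_right 0)"
      by (auto simp: eventually_at_right_field)
    \<comment> \<open>The term \<open>\<bar>z i\<bar> * \<tau>\<^sup>2\<close> will bound the old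
      third coordinate at the new scale; being quadratic, it does not affect the derivative at
      0.\<close>
    have "eventually (\<lambda>\<tau>. 1 < h (T - D * \<tau> - \<bar>z i\<bar> * \<tau>\<^sup>2) + a * 2 powr \<alpha> * \<tau>) (at_right 0)" for i
    proof -
      have "((\<lambda>\<tau>. h (T - D * \<tau> - \<bar>z i\<bar> * \<tau>\<^sup>2) + a * 2 powr \<alpha> * \<tau>) has_real_derivative
          H * - D + a * 2 powr \<alpha>) (at 0)"
        by (rule DERIV_add, rule DERIV_chain2[where f = h])
          (use H in \<open>auto intro!: derivative_eq_intros\<close>)
      moreover have "H * - D + a * 2 powr \<alpha> > 0" using HD a2 by (simp add: algebra_simps)
      ultimately obtain \<delta> where "\<delta> > 0" "\<And>\<tau>. 0 < \<tau> \<Longrightarrow> \<tau> < \<delta> \<Longrightarrow>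
          1 < h (T - D * \<tau> - \<bar>z i\<bar> * \<tau>\<^sup>2) + a * 2 powr \<alpha> * \<tau>"
        using DERIV_pos_inc_right T by force
      then show ?thesis by (auto simp: eventually_at_right_field)
    qed
    moreover have "eventually (\<lambda>\<tau>. 0 < T - D * \<tau> - \<bar>z i\<bar> * \<tau>\<^sup>2) (at_right 0)" for i
    proof -
      have "((\<lambda>\<tau>. T - D * \<tau> - \<bar>z i\<bar> * \<tau>\<^sup>2) \<longlongrightarrow> T - D * 0 - \<bar>z i\<bar> * 0\<^sup>2) (at_right 0)"
        by (intro tendsto_intros)
      then show ?thesis using T by (intro order_tendstoD) auto
    qed
    \<comment> \<open>For \<rho> = \<open>\<tau> powr (- 1 / \<alpha>)\<close> this says
      \<open>r i < \<rho>\<close>.\<close>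
    moreover have "eventually (\<lambda>\<tau>. \<tau> < r i powr - \<alpha>) (at_right 0)" if "i < n" for i
      using r_pos[OF that] by (intro eventually_at_right_field[THEN iffD2] exI[of _ "r i powr - \<alpha>"]) auto
    ultimately have "eventually (\<lambda>\<tau>. \<forall>i\<in>{..<n}.
        1 < h (T - D * \<tau> - \<bar>z i\<bar> * \<tau>\<^sup>2) + a * 2 powr \<alpha> * \<tau> \<and>
        0 < T - D * \<tau> - \<bar>z i\<bar> * \<tau>\<^sup>2 \<and> \<tau> < r i powr - \<alpha>) (at_right 0)"
      by (intro eventually_ball_finite) (auto intro!: eventually_conj)
    moreover have "eventually (\<lambda>\<tau>. \<tau> < (1::real)) (at_right 0)"
      by (intro eventually_at_right_field[THEN iffD2] exI[of _ 1]) auto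
    ultimately have "eventually (\<lambda>\<tau>. 0 < \<tau> \<and> \<tau> < 1 \<and> h (T - D * \<tau>) + a * \<tau> < 1 \<and> (\<forall>i\<in>{..<n}.
        1 < h (T - D * \<tau> - \<bar>z i\<bar> * \<tau>\<^sup>2) + a * 2 powr \<alpha> * \<tau> \<and>
        0 < T - D * \<tau> - \<bar>z i\<bar> * \<tau>\<^sup>2 \<and> \<tau> < r i powr - \<alpha>)) (at_right 0)"
      using ev1 by (intro eventually_conj eventually_at_right_less)
    from eventually_happens'[OF trivial_limit_at_right_real this]
    obtain \<tau> where \<tau>: "0 < \<tau>" "\<tau> < 1" and le1: "h (T - D * \<tau>) + a * \<tau> < 1"
      and gt1: "\<And>i. i \<in> {..<n} \<Longrightarrow> 1 < h (T - D * \<tau> - \<bar>z i\<bar> * \<tau>\<^sup>2) + a * 2 powr \<alpha> * \<tau>"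
      and arg: "\<And>i. i \<in> {..<n} \<Longrightarrow> 0 < T - D * \<tau> - \<bar>z i\<bar> * \<tau>\<^sup>2"
      and \<tau>r: "\<And>i. i \<in> {..<n} \<Longrightarrow> \<tau> < r i powr - \<alpha>"
      by blast
    define \<rho> where "\<rho> = \<tau> powr (- 1 / \<alpha>)"
    have \<rho>: "\<rho> > 0" using \<tau> by (simp add: \<rho>_def)
    have \<rho>\<alpha>: "\<rho> powr \<alpha> = 1 / \<tau>"
    proof -
      have "\<rho> powr \<alpha> = \<tau> powr (- 1 / \<alpha> * \<alpha>)"
        by (simp only: \<rho>_def powr_powr)
      also have "- 1 / \<alpha> * \<alpha> = - 1" using pos by simp
      finally show ?thesis using \<tau> by (simp add: powr_minus_divide)
    qed
    have scale: "(c / \<rho>) powr \<alpha> = c powr \<alpha> * \<tau>" if "c \<ge> 0" for c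
      using \<rho> \<tau> that by (simp add: powr_divide \<rho>\<alpha>)
    have "\<rho> \<ge> 1" using \<tau> pos by (simp add: \<rho>_def powr_le_one_le powr_minus_divide powr_le1)
    \<comment> \<open>Here \<alpha> \<le> 1 enters: as \<rho> \<ge> 1, it gives \<rho> \<ge>
      \<open>\<rho> powr \<alpha>\<close> = 1 / \<tau>.\<close>
    have \<rho>_s: "1 / \<rho> ^ s \<le> \<tau>\<^sup>2"
    proof -
      have "1 / \<tau> \<le> \<rho>" using powr_mono[OF assms \<open>\<rho> \<ge> 1\<close>] \<rho> by (simp add: \<rho>\<alpha>)
      then have "(1 / \<tau>)\<^sup>2 \<le> \<rho>\<^sup>2" using \<tau> by (intro power_mono) auto
      also have "\<dots> \<le> \<rho> ^ s" using s3 \<open>\<rho> \<ge> 1\<close> by (intro power_increasing) auto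
      finally show ?thesis using \<tau> \<rho> by (simp add: field_simps power_divide)
    qed
    define p where "p = (w, 0::real, (T - D * \<tau>) * \<rho> ^ s)"
    have "N (w / \<rho>) (0 / \<rho> ^ (s - 1)) ((T - D * \<tau>) * \<rho> ^ s / \<rho> ^ s) \<le> 1"
      using le1 \<rho> w by (simp add: N_def scale a_def mult.assoc add.commute)
    then have adm: "admissible p \<rho>" unfolding p_def using \<rho> by (intro admissibleI) auto
    have "r i < \<rho> \<and> \<rho> < hdist (P i) p" if i: "i < n" for i
    proof
      have "\<rho> powr - \<alpha> < r i powr - \<alpha>" using \<tau>r[of i] i \<rho>\<alpha> \<tau> by (simp add: powr_minus_divide)
      then show "r i < \<rho>" using \<rho> r_pos[OF i] pos
        by (metis linorder_not_less neg_less_0_iff_less order_less_imp_le powr_mono2')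
      let ?\<zeta> = "((T - D * \<tau>) * \<rho> ^ s - z i) / \<rho> ^ s"
      have "a * 2 powr \<alpha> * \<tau> = A * (2 * w / \<rho>) powr \<alpha>"
        using w by (simp add: scale a_def powr_mult)
      also have "\<dots> \<le> A * \<bar>(w - x i) / \<rho>\<bar> powr \<alpha>"
        using w_le[OF i] w \<rho> pos
        by (intro mult_left_mono powr_mono2) (auto simp: abs_divide intro!: divide_right_mono)
      finally have 1: "a * 2 powr \<alpha> * \<tau> \<le> A * \<bar>(w - x i) / \<rho>\<bar> powr \<alpha>" .
      have "z i / \<rho> ^ s \<le> \<bar>z i\<bar> * \<tau>\<^sup>2"
        using mult_mono[OF abs_ge_self[of "z i"] \<rho>_s] \<rho> by simp
      then have "T - D * \<tau> - \<bar>z i\<bar> * \<tau>\<^sup>2 \<le> ?\<zeta>"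
        using \<rho> by (simp add: diff_divide_distrib)
      then have "h (T - D * \<tau> - \<bar>z i\<bar> * \<tau>\<^sup>2) \<le> h ?\<zeta>"
        using arg[of i] i by (intro h_mono) auto
      with 1 gt1[of i] i have "1 < N ((w - x i) / \<rho>) (0 / \<rho> ^ (s - 1)) ?\<zeta>"
        by (simp add: N_def)
      then show "\<rho> < hdist (P i) p"
        unfolding P_eq[OF i] p_def hdist_def prod.case using \<rho> by (intro Inf_gauge_gt) auto
    qed
    then have "\<forall>i<n. r i < hdist p (P i) \<and> \<rho> < hdist (P i) p"
      by (auto simp: hdist_commute[of p] intro: less_trans)
    with adm w show "\<exists>p \<rho>. (admissible p \<rho> \<and> fst p > 0 \<and> fst (snd p) = 0) \<and>
        (\<forall>i<n. r i < hdist p (P i) \<and> \<rho> < hdist (P i) p)"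
      by (intro exI[of _ p] exI[of _ \<rho>]) (auto simp: p_def)
  qed
  then show ?thesis by metis
qed

text \<open>The criterion involves only distances between finitely many points, so it can be checked
  on an isometric copy, whatever the balls look like outside it.\<close>

lemma not_BCP_if_contains_hdist:
  assumes emb: "\<And>p q. d (f p) (f q) = hdist p q"
  shows "\<not> BCP d"
proof (rule not_BCP_if_separated[where e = "f (0, 0, 0)"])
  fix n :: nat
  obtain P r where "\<forall>i<n. admissible (P i) (r i) \<and> (\<forall>j<n. j \<noteq> i \<longrightarrow> r j < hdist (P i) (P j))"
    using separated_large_exponent separated_small_exponent by (metis not_le)
  then show "\<exists>P r. \<forall>i<n. r i > 0 \<and> d (f (0, 0, 0)) (P i) \<le> r i \<and> d (P i) (P i) \<le> r i \<and>
             (\<forall>j<n. j \<noteq> i \<longrightarrow> r j < d (P i) (P j))"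
    by (intro exI[of _ "\<lambda>i. f (P i)"] exI[of _ r])
      (auto simp: emb admissible_def hdist_self_le)
qed

end

text \<open>The first form of \<open>K\<close> gives one exponent per nonzero coordinate of w, the
  second form a singleton \<open>I\<close>.\<close>

lemma heisenberg_gauge_powr_sum:
  fixes c \<gamma> :: "'i \<Rightarrow> real"
  assumes "A > 0" "\<alpha> > 0" "B > 0" "\<beta> > 0" "s \<ge> 3"
    and I: "finite I" "I \<noteq> {}" "\<And>i. i \<in> I \<Longrightarrow> c i > 0 \<and> \<gamma> i > 0"
  shows "heisenberg_gauge A \<alpha> B \<beta> (\<lambda>z. \<Sum>i\<in>I. c i * \<bar>z\<bar> powr \<gamma> i) s"
proof
  show "continuous_on UNIV (\<lambda>z. \<Sum>i\<in>I. c i * \<bar>z\<bar> powr \<gamma> i)"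
    using I by (intro continuous_intros continuous_on_powr') auto
  show "(\<Sum>i\<in>I. c i * \<bar>z\<bar> powr \<gamma> i) \<le> (\<Sum>i\<in>I. c i * \<bar>z'\<bar> powr \<gamma> i)"
    if "0 \<le> z" "z \<le> z'" for z z'
    using I that by (intro sum_mono mult_left_mono powr_mono2) (auto simp: less_imp_le)
  obtain k where k: "k \<in> I" using I by blast
  define z where "z = (1 / c k) powr (1 / \<gamma> k)"
  have "c k * \<bar>z\<bar> powr \<gamma> k = 1"
    using I(3)[OF k] by (simp add: z_def powr_powr)
  moreover have "c k * \<bar>z\<bar> powr \<gamma> k \<le> (\<Sum>i\<in>I. c i * \<bar>z\<bar> powr \<gamma> i)"
    using I by (intro member_le_sum[OF k]) (auto simp: less_imp_le)
  ultimately show "\<exists>z>0. 1 \<le> (\<Sum>i\<in>I. c i * \<bar>z\<bar> powr \<gamma> i)"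
    using I(3)[OF k] by (intro exI[of _ z]) (auto simp: z_def)
  show "\<exists>D>0. ((\<lambda>z. \<Sum>i\<in>I. c i * \<bar>z\<bar> powr \<gamma> i) has_real_derivative D) (at z)"
    if z: "z > 0" for z
  proof (intro exI conjI)
    have "((\<lambda>z. \<Sum>i\<in>I. c i * z powr \<gamma> i) has_real_derivative
        (\<Sum>i\<in>I. c i * (\<gamma> i * z powr (\<gamma> i - 1)))) (at z)"
      using z by (intro DERIV_sum DERIV_cmult has_real_derivative_powr)
    then show "((\<lambda>z. \<Sum>i\<in>I. c i * \<bar>z\<bar> powr \<gamma> i) has_real_derivative
        (\<Sum>i\<in>I. c i * (\<gamma> i * z powr (\<gamma> i - 1)))) (at z)"
      by (rule has_field_derivative_transform_within_open[of _ _ _ "{0<..}"]) (use z in auto)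
    show "0 < (\<Sum>i\<in>I. c i * (\<gamma> i * z powr (\<gamma> i - 1)))"
      using I z by (intro sum_pos) auto
  qed
qed (use assms in \<open>auto simp: sum.neutral\<close>)

subsection \<open>The Baker-Campbell-Hausdorff product in a Heisenberg subalgebra\<close>

lemma lie_bracket_antisym:
  assumes "lie_bracket br"
  shows "br x y = - br y x"
proof -
  have bil: "bilinear br" and alt: "\<And>x. br x x = 0"
    using assms by (auto simp: lie_bracket_def)
  have "br (x + y) (x + y) = br x y + br y x"
    unfolding bilinear_ladd[OF bil] bilinear_radd[OF bil] by (simp add: alt)
  then show ?thesis by (simp add: alt eq_neg_iff_add_eq_0)
qed

lemma bch_indices_2:
  "bch_indices 2 = {[(1, 0)], [(0, 1)], [(2, 0)], [(1, 1)], [(0, 2)], [(1, 0), (1, 0)],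
     [(1, 0), (0, 1)], [(0, 1), (1, 0)], [(0, 1), (0, 1)]}"
proof (intro equalityI subsetI)
  fix ps assume ps: "ps \<in> bch_indices 2"
  show "ps \<in> {[(1, 0)], [(0, 1)], [(2, 0)], [(1, 1)], [(0, 2)], [(1, 0), (1, 0)],
     [(1, 0), (0, 1)], [(0, 1), (1, 0)], [(0, 1), (0, 1)]}"
  \<comment> \<open>This rule separates empty, one-element and longer lists.\<close>
  proof (cases ps rule: remdups_adj.cases)
    case (2 p)
    with ps show ?thesis
      by (cases p) (auto simp: bch_indices_def bch_degree_def)
  next
    case (3 p q qs)
    with ps have "qs = []"
      by (cases p; cases q; cases qs) (auto simp: bch_indices_def bch_degree_def)
    obtain a b c d where pq: "p = (a, b)" "q = (c, d)" by (metis surj_pair)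
    with 3 ps \<open>qs = []\<close> have "a + b = 1" "c + d = 1"
      by (auto simp: bch_indices_def bch_degree_def)
    then have "(a, b) \<in> {(1, 0), (0, 1)}" "(c, d) \<in> {(1, 0), (0, 1)}"
      by (auto simp: add_is_1)
    with 3 \<open>qs = []\<close> pq show ?thesis by auto
  qed (use ps in \<open>simp add: bch_indices_def\<close>)
qed (auto simp: bch_indices_def bch_degree_def)

lemma length_bch_word:
  "length (concat (map (\<lambda>(a, b). replicate a x @ replicate b y) ps)) = bch_degree ps"
  by (induction ps) (auto simp: bch_degree_def)

lemma set_bch_word:
  "set (concat (map (\<lambda>(a, b). replicate a x @ replicate b y) ps)) \<subseteq> {x, y}"
proof
  fix z assume "z \<in> set (concat (map (\<lambda>(a, b). replicate a x @ replicate b y) ps))"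
  then obtain p where "z \<in> set ((\<lambda>(a, b). replicate a x @ replicate b y) p)"
    unfolding set_concat set_map by blast
  then have "z \<in> set (replicate (fst p) x @ replicate (snd p) y)"
    by (simp add: case_prod_unfold)
  then show "z \<in> {x, y}" by (auto dest: in_set_replicate[THEN iffD1])
qed

text \<open>A nested bracket of at least two letters \<open>x\<close>, \<open>y\<close> is a
  multiple of \<open>br x y\<close>, which both letters annihilate. Hence words of length at least 3
  contribute 0 and only degrees up to 2 remain.\<close>

lemma bch_heisenberg:
  fixes br :: "'g::real_vector \<Rightarrow> 'g \<Rightarrow> 'g"
  assumes br: "lie_bracket br" and central: "br x (br x y) = 0" "br y (br x y) = 0" and "s \<ge> 2"
  shows "bch br s x y = x + y + (1 / 2) *\<^sub>R br x y"
proof -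
  have bil: "bilinear br" and alt: "\<And>x. br x x = 0"
    using br by (auto simp: lie_bracket_def)
  have anti: "br y x = - br x y" using lie_bracket_antisym[OF br] .
  have two: "\<exists>k. nested_bracket br zs = k *\<^sub>R br x y" if "set zs \<subseteq> {x, y}" "length zs \<ge> 2" for zs
    using that
  proof (induction zs rule: induct_list012)
    case (3 z w zs)
    show ?case
    proof (cases zs)
      case Nil
      with 3 show ?thesis
        by (auto simp: alt anti intro: exI[of _ 0] exI[of _ 1] exI[of _ "- 1"])
    next
      case (Cons v vs)
      with 3 obtain k where "nested_bracket br (w # zs) = k *\<^sub>R br x y" by auto
      with 3 show ?thesis
        by (auto simp: bilinear_rmul[OF bil] central intro: exI[of _ 0])
    qed
  qed auto
  have three: "nested_bracket br zs = 0" if zs: "set zs \<subseteq> {x, y}" "length zs \<ge> 3" for zs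
  proof -
    obtain z w v vs where eq: "zs = z # w # v # vs"
      using zs by (auto simp: numeral_3_eq_3 Suc_le_length_iff)
    with zs two[of "w # v # vs"] obtain k where "nested_bracket br (w # v # vs) = k *\<^sub>R br x y"
      by auto
    with zs show ?thesis
      by (auto simp: eq bilinear_rmul[OF bil] central)
  qed
  let ?w = "\<lambda>ps. concat (map (\<lambda>(a, b). replicate a x @ replicate b y) ps)"
  have "bch br s x y = (\<Sum>ps\<in>bch_indices 2.
     ((-1) ^ (length ps - 1) /
       (real (length ps) * real (bch_degree ps) * (\<Prod>(a, b)\<leftarrow>ps. fact a * fact b))) *\<^sub>R
     nested_bracket br (?w ps))"
    unfolding bch_def
  proof (rule sum.mono_neutral_right[OF finite_bch_indices])
    show "bch_indices 2 \<subseteq> bch_indices s"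
      using \<open>s \<ge> 2\<close> by (auto simp: bch_indices_def)
    have "nested_bracket br (?w ps) = 0" if "ps \<in> bch_indices s - bch_indices 2" for ps
    proof (rule three)
      show "length (?w ps) \<ge> 3"
        unfolding length_bch_word using that by (auto simp: bch_indices_def)
    qed (rule set_bch_word)
    then show "\<forall>ps\<in>bch_indices s - bch_indices 2.
      ((-1) ^ (length ps - 1) /
       (real (length ps) * real (bch_degree ps) * (\<Prod>(a, b)\<leftarrow>ps. fact a * fact b))) *\<^sub>R
       nested_bracket br (?w ps) = 0"
      by simp
  qed
  \<comment> \<open>The index \<open>[(1, 1)]\<close> gives 1/2; \<open>[(1, 0), (0, 1)]\<close> and
    \<open>[(0, 1), (1, 0)]\<close> give -1/4 each, and these two cancel by antisymmetry.\<close>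
  also have "\<dots> = x + y + (1 / 2) *\<^sub>R br x y + (- (1 / 4)) *\<^sub>R br x y + (- (1 / 4)) *\<^sub>R br y x"
    unfolding bch_indices_2
    by (simp add: bch_degree_def alt numeral_2_eq_2)
  also have "\<dots> = x + y + (1 / 2) *\<^sub>R br x y"
    by (simp add: anti)
  finally show ?thesis .
qed

subsection \<open>Stratified Lie algebras in coordinates\<close>

lemma linear_lie_of_coords: "linear (lie_of_coords X)"
  by (rule linearI)
    (simp_all add: lie_of_coords_def scaleR_left_distrib sum.distrib scaleR_sum_right)

text \<open>Directness of the sum separates the layers, independence the coordinates within a layer.
  Injectivity lets \<open>inv\<close> in \<open>carnot_mult\<close> really recover
  coordinates.\<close>

lemma inj_lie_of_coords:
  fixes X :: "'n::finite \<Rightarrow> 'g::real_vector"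
  assumes strat: "stratification br s V" and basis: "adapted_basis s V X deg"
  shows "inj (lie_of_coords X)"
proof (rule injI)
  fix x y assume eq: "lie_of_coords X x = lie_of_coords X y"
  have inj: "inj X" and deg: "\<And>i. deg i \<in> {1..s}"
    and ind: "\<And>j. j \<in> {1..s} \<Longrightarrow> independent (X ` {i. deg i = j})"
    and span: "\<And>j. j \<in> {1..s} \<Longrightarrow> span (X ` {i. deg i = j}) = V j"
    using basis unfolding adapted_basis_def by blast+
  \<comment> \<open>Restricted to \<open>{1..s}\<close> because \<open>stratification\<close> states
    uniqueness for extensional functions.\<close>
  define part where "part x = (\<lambda>j\<in>{1..s}. \<Sum>i\<in>{i. deg i = j}. (x $ i) *\<^sub>R X i)" for x :: "real ^ 'n"
  have part: "part x \<in> (\<Pi>\<^sub>E j\<in>{1..s}. V j)" for x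
  proof -
    have "(\<Sum>i\<in>{i. deg i = j}. (x $ i) *\<^sub>R X i) \<in> V j" if "j \<in> {1..s}" for j
      unfolding span[OF that, symmetric] by (intro span_sum span_scale span_base) auto
    then show ?thesis by (simp add: part_def)
  qed
  have sum_part: "lie_of_coords X x = (\<Sum>j=1..s. part x j)" for x
  proof -
    have "(\<Sum>j=1..s. part x j) = (\<Sum>j=1..s. \<Sum>i\<in>{i \<in> UNIV. deg i = j}. (x $ i) *\<^sub>R X i)"
      by (simp add: part_def)
    also have "\<dots> = lie_of_coords X x"
      unfolding lie_of_coords_def using deg by (intro sum.group) auto
    finally show ?thesis by simp
  qed
  have "part x = part y"
    using strat part[of x] part[of y] sum_part[of x] sum_part[of y] eq
    unfolding stratification_def by metis
  have "x $ k = y $ k" for k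
  proof -
    define j where "j = deg k"
    have j: "j \<in> {1..s}" using deg by (simp add: j_def)
    have "(\<Sum>i\<in>{i. deg i = j}. (x $ i - y $ i) *\<^sub>R X i) = part x j - part y j"
      using j by (simp add: part_def scaleR_left_diff_distrib sum_subtractf)
    also have "\<dots> = 0" using \<open>part x = part y\<close> by simp
    finally have "(\<Sum>v\<in>X ` {i. deg i = j}. (x $ inv X v - y $ inv X v) *\<^sub>R v) = 0"
      using inj by (subst sum.reindex) (auto intro: inj_on_subset)
    moreover have "X k \<in> X ` {i. deg i = j}" by (simp add: j_def)
    ultimately have "x $ inv X (X k) - y $ inv X (X k) = 0"
      using independentD[OF ind[OF j], of "X ` {i. deg i = j}" "\<lambda>v. x $ inv X v - y $ inv X v"]
      by auto
    with inj show ?thesis by simp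
  qed
  then show "x = y" by (simp add: vec_eq_iff)
qed

text \<open>The stratification gives this for \<open>V 1\<close>. Layer \<open>j + 1\<close> is
  spanned by brackets of \<open>a\<close> in \<open>V 1\<close> and \<open>b\<close> in
  \<open>V j\<close>, and the Jacobi identity reduces such a bracket to \<open>br a y\<close> and
  \<open>br b y\<close>.\<close>

lemma bracket_top_layer:
  assumes br: "lie_bracket br" and strat: "stratification br s V"
    and "j \<in> {1..s}" and "x \<in> V j" and y: "y \<in> V s"
  shows "br x y = 0"
proof -
  have bil: "bilinear br"
    and jacobi: "\<And>x y z. br x (br y z) + br y (br z x) + br z (br x y) = 0"
    using br by (auto simp: lie_bracket_def)
  note anti = lie_bracket_antisym[OF br]
  have one: "br x y = 0" if "x \<in> V 1" for x
  proof -
    have "br x y \<in> span {br x y | x y. x \<in> V 1 \<and> y \<in> V s}"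
      using that y by (intro span_base) blast
    also have "\<dots> = {0}" using strat by (simp add: stratification_def)
    finally show ?thesis by simp
  qed
  from \<open>j \<in> {1..s}\<close> have "1 \<le> j" "j \<le> s" by auto
  then show ?thesis using \<open>x \<in> V j\<close>
  proof (induction j arbitrary: x rule: dec_induct)
    case base
    then show ?case using one by simp
  next
    case (step j)
    then have "x \<in> span {br x y | x y. x \<in> V 1 \<and> y \<in> V j}"
      using strat by (simp add: stratification_def)
    moreover have low: "br b y = 0" if "b \<in> V j" for b
      using step that by simp
    ultimately show ?case
    proof (induction rule: span_induct)
      case base
      show ?case
        by (auto simp: subspace_def bilinear_lzero[OF bil] bilinear_ladd[OF bil] bilinear_lmul[OF bil])
    next
      case (step u)
      then obtain a b where u: "u = br a b" "a \<in> V 1" "b \<in> V j" by blast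
      have "br a y = 0" "br b y = 0" using one low u by auto
      then have "br y a = 0" "br y b = 0" using anti[of y] by simp_all
      then have "br y u = 0"
        using jacobi[of y a b] \<open>br b y = 0\<close> by (simp add: u bilinear_rzero[OF bil])
      then show ?case using anti[of u y] by simp
    qed
  qed
qed

text \<open>Otherwise bilinearity would kill all brackets of \<open>V 1\<close> with
  \<open>V (s - 1)\<close>, although they span \<open>V s\<close>. Basis vectors are wanted so that
  x and y are single coordinates in \<open>K\<close>.\<close>

lemma ex_basis_bracket_nonzero:
  fixes X :: "'n::finite \<Rightarrow> 'g::real_vector"
  assumes br: "lie_bracket br" and strat: "stratification br s V"
    and basis: "adapted_basis s V X deg" and "s \<ge> 2"
  shows "\<exists>a b. deg a = 1 \<and> deg b = s - 1 \<and> br (X a) (X b) \<noteq> 0"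
proof (rule ccontr)
  assume "\<not> ?thesis"
  then have zero: "br (X a) (X b) = 0" if "deg a = 1" "deg b = s - 1" for a b
    using that by blast
  have bil: "bilinear br" using br by (simp add: lie_bracket_def)
  have span: "\<And>j. j \<in> {1..s} \<Longrightarrow> V j = span (X ` {i. deg i = j})"
    using basis by (auto simp: adapted_basis_def)
  have "br u v = 0" if "u \<in> V 1" "v \<in> V (s - 1)" for u v
  proof (rule bilinear_eq[OF bil])
    show "bilinear (\<lambda>(_::'g) (_::'g). 0::'g)"
      by (simp add: bilinear_def linear_iff)
    show "V 1 \<subseteq> span (X ` {i. deg i = 1})" "V (s - 1) \<subseteq> span (X ` {i. deg i = s - 1})"
      using span[of 1] span[of "s - 1"] \<open>s \<ge> 2\<close> by auto
  qed (use that zero in auto)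
  then have "{br x y | x y. x \<in> V 1 \<and> y \<in> V (s - 1)} \<subseteq> {0}" by auto
  then have "span {br x y | x y. x \<in> V 1 \<and> y \<in> V (s - 1)} \<subseteq> {0}"
    by (intro span_minimal subspace_single_0)
  moreover have "\<forall>j. 1 \<le> j \<and> j < s \<longrightarrow> span {br x y | x y. x \<in> V 1 \<and> y \<in> V j} = V (j + 1)"
    using strat by (simp add: stratification_def)
  from this[rule_format, of "s - 1"] have
    "span {br x y | x y. x \<in> V 1 \<and> y \<in> V (s - 1)} = V s"
    using \<open>s \<ge> 2\<close> by simp
  moreover have "subspace (V s)" "V s \<noteq> {0}"
    using strat by (auto simp: stratification_def)
  ultimately show False using subspace_0 by blast
qed

text \<open>Applied to w, which need not be a basis vector.\<close>

lemma coords_of_layer: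
  fixes X :: "'n::finite \<Rightarrow> 'g::real_vector"
  assumes basis: "adapted_basis s V X deg" and "j \<in> {1..s}" and "v \<in> V j"
  obtains W where "lie_of_coords X W = v" "\<And>i. deg i \<noteq> j \<Longrightarrow> W $ i = 0"
proof -
  have "v \<in> span (X ` {i. deg i = j})" and inj: "inj X"
    using assms by (auto simp: adapted_basis_def)
  then obtain u where u: "v = (\<Sum>w\<in>X ` {i. deg i = j}. u w *\<^sub>R w)"
    by (auto simp: span_finite)
  define W :: "real ^ 'n" where "W = (\<chi> i. if deg i = j then u (X i) else 0)"
  have "lie_of_coords X W = (\<Sum>i\<in>{i. deg i = j}. u (X i) *\<^sub>R X i)"
    unfolding lie_of_coords_def W_def by (intro sum.mono_neutral_cong_right) auto
  also have "\<dots> = v" unfolding u using inj by (subst sum.reindex) (auto intro: inj_on_subset)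
  finally show thesis using that[of W] by (simp add: W_def)
qed

subsection \<open>The Heisenberg subgroup\<close>

definition emb :: "'n::finite \<Rightarrow> 'n \<Rightarrow> real ^ 'n \<Rightarrow> real \<Rightarrow> real \<Rightarrow> real \<Rightarrow> real ^ 'n" where
  "emb a b W x y z = axis a x + axis b y + z *\<^sub>R W"

lemma emb_nth:
  assumes "a \<noteq> b" "W $ a = 0" "W $ b = 0"
  shows "emb a b W x y z $ i = (if i = a then x else if i = b then y else z * W $ i)"
  using assms by (auto simp: emb_def axis_def)

lemma emb_minus: "- emb a b W x y z = emb a b W (- x) (- y) (- z)"
  by (simp add: emb_def vec_eq_iff axis_def)

lemma lie_of_coords_axis: "lie_of_coords X (axis a x) = x *\<^sub>R X a"
  unfolding lie_of_coords_def axis_def by (simp add: if_distrib[of "\<lambda>x. x *\<^sub>R _"] cong: if_cong)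

lemma lie_of_coords_emb:
  "lie_of_coords X (emb a b W x y z) = x *\<^sub>R X a + y *\<^sub>R X b + z *\<^sub>R lie_of_coords X W"
  by (simp add: emb_def linear_add[OF linear_lie_of_coords] linear_scale[OF linear_lie_of_coords]
      lie_of_coords_axis)

text \<open>Brackets within the span of \<open>X a\<close>, \<open>X b\<close> and w are multiples
  of w, which is central there, so \<open>bch_heisenberg\<close> applies.\<close>

lemma carnot_mult_emb:
  assumes br: "lie_bracket br" and inj: "inj (lie_of_coords X)" and "s \<ge> 2"
    and W: "lie_of_coords X W = br (X a) (X b)"
    and central: "br (X a) (br (X a) (X b)) = 0" "br (X b) (br (X a) (X b)) = 0"
  shows "carnot_mult br s X (emb a b W x y z) (emb a b W x' y' z') =
    emb a b W (x + x') (y + y') (z + z' + (x * y' - y * x') / 2)"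
proof -
  define u v w where "u = X a" and "v = X b" and "w = br (X a) (X b)"
  have bil: "bilinear br" and alt: "\<And>x. br x x = 0"
    using br by (auto simp: lie_bracket_def)
  note anti = lie_bracket_antisym[OF br]
  have brs: "br u v = w" "br v u = - w" "br u w = 0" "br v w = 0" "br w u = 0" "br w v = 0"
    using central anti[of v u] anti[of w u] anti[of w v] by (simp_all add: u_def v_def w_def)
  note expand = bilinear_ladd[OF bil] bilinear_radd[OF bil] bilinear_lmul[OF bil]
    bilinear_rmul[OF bil] bilinear_rzero[OF bil] alt brs
  let ?p = "x *\<^sub>R u + y *\<^sub>R v + z *\<^sub>R w" and ?q = "x' *\<^sub>R u + y' *\<^sub>R v + z' *\<^sub>R w"
  have pq: "br ?p ?q = (x * y' - y * x') *\<^sub>R w"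
    by (simp add: expand scaleR_left_diff_distrib mult.commute)
  have "br ?p (br ?p ?q) = 0" "br ?q (br ?p ?q) = 0"
    unfolding pq by (simp_all add: expand)
  from bch_heisenberg[OF br this \<open>s \<ge> 2\<close>]
  have "bch br s ?p ?q = ?p + ?q + ((x * y' - y * x') / 2) *\<^sub>R w"
    by (simp add: pq)
  also have "\<dots> = lie_of_coords X (emb a b W (x + x') (y + y') (z + z' + (x * y' - y * x') / 2))"
    by (simp add: lie_of_coords_emb W u_def v_def w_def scaleR_left_distrib)
  finally have bch: "bch br s ?p ?q = \<dots>" .
  have "lie_of_coords X (emb a b W x y z) = ?p" "lie_of_coords X (emb a b W x' y' z') = ?q"
    by (simp_all add: lie_of_coords_emb W u_def v_def w_def)
  then show ?thesis
    by (simp only: carnot_mult_def bch inv_f_f[OF inj])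
qed

text \<open>Layers 1, \<open>s - 1\<close> and \<open>s\<close> are distinct since s \<ge> 3, so
  \<open>a\<close>, \<open>b\<close> and the support of \<open>W\<close> are disjoint and the
  defining sum splits into three parts, the last one being \<open>h\<close>.\<close>

lemma emb_mem_K:
  fixes deg :: "'n::finite \<Rightarrow> nat" and W :: "real ^ 'n"
  assumes K: "(\<exists>c \<gamma> :: 'n \<Rightarrow> real. (\<forall>i. c i > 0 \<and> \<gamma> i > 0) \<and>
            K = {x. (\<Sum>i\<in>UNIV. c i * \<bar>x $ i\<bar> powr \<gamma> i) \<le> 1}) \<or>
         (\<exists>c \<gamma> :: nat \<Rightarrow> real. (\<forall>j\<in>{1..s}. c j > 0 \<and> \<gamma> j > 0) \<and>
            K = {x. (\<Sum>j=1..s. c j * L2_set (\<lambda>i. x $ i) {i. deg i = j} powr \<gamma> j) \<le> 1})"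
    and "s \<ge> 3" and ab: "deg a = 1" "deg b = s - 1"
    and W: "\<And>i. deg i \<noteq> s \<Longrightarrow> W $ i = 0" "W \<noteq> 0"
  obtains A \<alpha> B \<beta> h where "heisenberg_gauge A \<alpha> B \<beta> h s"
    "\<And>x y z. emb a b W x y z \<in> K \<longleftrightarrow> A * \<bar>x\<bar> powr \<alpha> + B * \<bar>y\<bar> powr \<beta> + h z \<le> 1"
proof -
  have [simp]: "a \<noteq> b" "b \<noteq> a" "W $ a = 0" "W $ b = 0"
    using ab W(1) \<open>s \<ge> 3\<close> by auto
  note nth = emb_nth[OF this(1,3,4)]
  from K show thesis
  proof (elim disjE exE conjE)
    fix c \<gamma> :: "'n \<Rightarrow> real"
    assume pos: "\<forall>i. c i > 0 \<and> \<gamma> i > 0"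
      and K_eq: "K = {x. (\<Sum>i\<in>UNIV. c i * \<bar>x $ i\<bar> powr \<gamma> i) \<le> 1}"
    define I where "I = {i. W $ i \<noteq> 0}"
    define h where "h z = (\<Sum>i\<in>I. (c i * \<bar>W $ i\<bar> powr \<gamma> i) * \<bar>z\<bar> powr \<gamma> i)" for z
    have "I \<noteq> {}" using W(2) by (auto simp: I_def vec_eq_iff)
    then have "heisenberg_gauge (c a) (\<gamma> a) (c b) (\<gamma> b) h s"
      unfolding h_def using pos \<open>s \<ge> 3\<close> by (intro heisenberg_gauge_powr_sum) (auto simp: I_def)
    moreover have "(\<Sum>i\<in>UNIV. c i * \<bar>emb a b W x y z $ i\<bar> powr \<gamma> i) =
        c a * \<bar>x\<bar> powr \<gamma> a + c b * \<bar>y\<bar> powr \<gamma> b + h z" for x y z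
    proof -
      have "(\<Sum>i\<in>UNIV. c i * \<bar>emb a b W x y z $ i\<bar> powr \<gamma> i) =
          (\<Sum>i\<in>insert a (insert b I). c i * \<bar>emb a b W x y z $ i\<bar> powr \<gamma> i)"
        by (intro sum.mono_neutral_right) (auto simp: nth I_def)
      also have "\<dots> = c a * \<bar>x\<bar> powr \<gamma> a + c b * \<bar>y\<bar> powr \<gamma> b +
          (\<Sum>i\<in>I. c i * \<bar>emb a b W x y z $ i\<bar> powr \<gamma> i)"
        by (simp add: nth I_def)
      also have "(\<Sum>i\<in>I. c i * \<bar>emb a b W x y z $ i\<bar> powr \<gamma> i) = h z"
        unfolding h_def by (intro sum.cong) (auto simp: nth I_def abs_mult powr_mult)
      finally show ?thesis .
    qed
    ultimately show thesis using that[of "c a" "\<gamma> a" "c b" "\<gamma> b" h] by (simp add: K_eq)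
  next
    fix c \<gamma> :: "nat \<Rightarrow> real"
    assume pos: "\<forall>j\<in>{1..s}. c j > 0 \<and> \<gamma> j > 0"
      and K_eq: "K = {x. (\<Sum>j=1..s. c j * L2_set (\<lambda>i. x $ i) {i. deg i = j} powr \<gamma> j) \<le> 1}"
    define l where "l = L2_set (\<lambda>i. W $ i) {i. deg i = s}"
    define h where "h z = (\<Sum>j\<in>{s}. (c j * l powr \<gamma> j) * \<bar>z\<bar> powr \<gamma> j)" for z
    have "l \<noteq> 0" using W by (auto simp: l_def vec_eq_iff L2_set_eq_0_iff)
    then have "l > 0" using L2_set_nonneg[of "\<lambda>i. W $ i"] by (simp add: l_def less_le)
    have "1 \<in> {1..s}" "s - 1 \<in> {1..s}" "s \<in> {1..s}" using \<open>s \<ge> 3\<close> by auto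
    then have "heisenberg_gauge (c 1) (\<gamma> 1) (c (s - 1)) (\<gamma> (s - 1)) h s"
      unfolding h_def using pos \<open>s \<ge> 3\<close> \<open>l > 0\<close> by (intro heisenberg_gauge_powr_sum) auto
    moreover have "(\<Sum>j=1..s. c j * L2_set (\<lambda>i. emb a b W x y z $ i) {i. deg i = j} powr \<gamma> j) =
        c 1 * \<bar>x\<bar> powr \<gamma> 1 + c (s - 1) * \<bar>y\<bar> powr \<gamma> (s - 1) + h z" for x y z
    proof -
      have single: "L2_set f J = \<bar>f k\<bar>" if "k \<in> J" "\<And>i. i \<in> J \<Longrightarrow> i \<noteq> k \<Longrightarrow> f i = 0"
        for f :: "'n \<Rightarrow> real" and J k
      proof -
        have "(\<Sum>i\<in>J. (f i)\<^sup>2) = (\<Sum>i\<in>{k}. (f i)\<^sup>2)"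
          using that by (intro sum.mono_neutral_right) auto
        then show ?thesis by (simp add: L2_set_def)
      qed
      let ?L = "\<lambda>j. L2_set (\<lambda>i. emb a b W x y z $ i) {i. deg i = j}"
      have L1: "?L 1 = \<bar>x\<bar>"
        using ab W(1) \<open>s \<ge> 3\<close> by (subst single[of a]) (auto simp: nth)
      have L2: "?L (s - 1) = \<bar>y\<bar>"
        using ab W(1) \<open>s \<ge> 3\<close> by (subst single[of b]) (auto simp: nth)
      have "?L s = L2_set (\<lambda>i. \<bar>z\<bar> * W $ i) {i. deg i = s}"
        unfolding L2_set_def using ab \<open>s \<ge> 3\<close>
        by (intro arg_cong[where f = sqrt] sum.cong) (auto simp: nth power_mult_distrib)
      then have L3: "?L s = \<bar>z\<bar> * l"
        by (simp add: l_def L2_set_right_distrib)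
      have L0: "?L j = 0" if "j \<notin> {1, s - 1, s}" for j
        using that ab W(1) by (auto simp: L2_set_eq_0_iff nth)
      have "(\<Sum>j=1..s. c j * ?L j powr \<gamma> j) = (\<Sum>j\<in>{1, s - 1, s}. c j * ?L j powr \<gamma> j)"
        using \<open>s \<ge> 3\<close> L0 by (intro sum.mono_neutral_right) auto
      also have "\<dots> = c 1 * ?L 1 powr \<gamma> 1 + c (s - 1) * ?L (s - 1) powr \<gamma> (s - 1) + c s * ?L s powr \<gamma> s"
        using \<open>s \<ge> 3\<close> by simp
      also have "\<dots> = c 1 * \<bar>x\<bar> powr \<gamma> 1 + c (s - 1) * \<bar>y\<bar> powr \<gamma> (s - 1) + h z"
        unfolding L1 L2 L3 using \<open>l > 0\<close> by (simp add: h_def powr_mult)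
      finally show ?thesis .
    qed
    ultimately show thesis
      using that[of "c 1" "\<gamma> 1" "c (s - 1)" "\<gamma> (s - 1)" h] by (simp add: K_eq)
  qed
qed

theorem theorem1p6:
  fixes br :: "'g::real_vector \<Rightarrow> 'g \<Rightarrow> 'g"
    and V :: "nat \<Rightarrow> 'g set"
    and s :: nat
    and X :: "'n::finite \<Rightarrow> 'g"
    and deg :: "'n \<Rightarrow> nat"
    and K :: "(real ^ 'n) set"
  assumes "lie_bracket br"
    and "stratification br s V"
    and "s \<ge> 3"
    and "adapted_basis s V X deg"
    and "(\<exists>c \<gamma> :: 'n \<Rightarrow> real. (\<forall>i. c i > 0 \<and> \<gamma> i > 0) \<and>
            K = {x. (\<Sum>i\<in>UNIV. c i * \<bar>x $ i\<bar> powr \<gamma> i) \<le> 1}) \<or>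
         (\<exists>c \<gamma> :: nat \<Rightarrow> real. (\<forall>j\<in>{1..s}. c j > 0 \<and> \<gamma> j > 0) \<and>
            K = {x. (\<Sum>j=1..s. c j * L2_set (\<lambda>i. x $ i) {i. deg i = j} powr \<gamma> j) \<le> 1})"
  shows "\<not> BCP (induced_dist br s X deg K)"
proof -
  note br = assms(1) and strat = assms(2) and s3 = assms(3) and basis = assms(4)
  have layer: "X i \<in> V (deg i)" for i
  proof -
    have "deg i \<in> {1..s}" using basis unfolding adapted_basis_def by blast
    then have "span (X ` {k. deg k = deg i}) = V (deg i)"
      using basis by (simp add: adapted_basis_def)
    then show ?thesis using span_base[of "X i" "X ` {k. deg k = deg i}"] by auto
  qed
  obtain a b where ab: "deg a = 1" "deg b = s - 1" and nz: "br (X a) (X b) \<noteq> 0"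
    using ex_basis_bracket_nonzero[OF br strat basis] s3 by auto
  have mem: "X a \<in> V 1" "X b \<in> V (s - 1)"
    using layer[of a] layer[of b] ab by auto
  have "\<forall>j. 1 \<le> j \<and> j < s \<longrightarrow> span {br x y | x y. x \<in> V 1 \<and> y \<in> V j} = V (j + 1)"
    using strat by (simp add: stratification_def)
  from this[rule_format, of "s - 1"] have
    "span {br x y | x y. x \<in> V 1 \<and> y \<in> V (s - 1)} = V s"
    using s3 by simp
  then have top: "br (X a) (X b) \<in> V s"
    using mem by (metis (mono_tags, lifting) mem_Collect_eq span_base)
  have central: "br (X a) (br (X a) (X b)) = 0" "br (X b) (br (X a) (X b)) = 0"
    using bracket_top_layer[OF br strat _ mem(1) top] bracket_top_layer[OF br strat _ mem(2) top] s3
    by auto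
  obtain W where W: "lie_of_coords X W = br (X a) (X b)" "\<And>i. deg i \<noteq> s \<Longrightarrow> W $ i = 0"
    using coords_of_layer[OF basis _ top] s3 by auto
  have "W \<noteq> 0"
    using W(1) nz linear_0[OF linear_lie_of_coords, of X] by auto
  obtain A \<alpha> B \<beta> h where gauge: "heisenberg_gauge A \<alpha> B \<beta> h s" and
    K: "\<And>x y z. emb a b W x y z \<in> K \<longleftrightarrow> A * \<bar>x\<bar> powr \<alpha> + B * \<bar>y\<bar> powr \<beta> + h z \<le> 1"
    using emb_mem_K[OF assms(5) s3 ab W(2) \<open>W \<noteq> 0\<close>] by metis
  interpret heisenberg_gauge A \<alpha> B \<beta> h s by (fact gauge)
  have "a \<noteq> b" "W $ a = 0" "W $ b = 0" using ab W(2) s3 by auto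
  note nth = emb_nth[OF this]
  \<comment> \<open>Dilations preserve the subgroup; \<open>W\<close> has weight \<open>s\<close>
    because it is supported in the top layer.\<close>
  have dil: "dilation deg (1 / t) (emb a b W x y z) = emb a b W (x / t) (y / t ^ (s - 1)) (z / t ^ s)"
    for t x y z
  proof -
    have "(1 / t) ^ deg i * emb a b W x y z $ i = emb a b W (x / t) (y / t ^ (s - 1)) (z / t ^ s) $ i" for i
      using ab W(2)[of i] by (cases "deg i = s") (auto simp: nth power_one_over)
    then show ?thesis by (simp add: dilation_def vec_eq_iff)
  qed
  have mult: "carnot_mult br s X (carnot_inverse (emb a b W x y z)) (emb a b W x' y' z') =
      emb a b W (x' - x) (y' - y) (z' - z - (x * y' - y * x') / 2)" for x y z x' y' z'
  proof -
    have *: "- x + x' = x' - x" "- y + y' = y' - y"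
      "- z + z' + (- x * y' - - y * x') / 2 = z' - z - (x * y' - y * x') / 2"
      by (simp_all add: field_simps)
    show ?thesis
      unfolding carnot_inverse_def emb_minus *[symmetric] using s3
      by (intro carnot_mult_emb[OF br inj_lie_of_coords[OF strat basis] _ W(1) central]) simp
  qed
  show ?thesis
  proof (rule not_BCP_if_contains_hdist)
    \<comment> \<open>On the subgroup the set whose infimum is taken is exactly a
      \<open>gauge_set\<close>.\<close>
    show "induced_dist br s X deg K ((\<lambda>(x, y, z). emb a b W x y z) p) ((\<lambda>(x, y, z). emb a b W x y z) q)
        = hdist p q" for p q
      by (cases p, cases q) (simp add: induced_dist_def mult dil K hdist_def gauge_set_def N_def)
  qed
qed

end
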